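(* Consider a circuit in the class RLCM$a$ (described in the context, with all memristor and topological assumptions stated there), so that every one of the $n_C$ capacitors has a flux-controlled memristor in parallel ($n_\Phi=n_C$) and there are no other memristors. Let $$H_{\alpha\alpha}=A_{CR}R_{\mathcal L}^{-1}A_{CR}^\top,\quad H_{\alpha\beta}=A_{CL},\quad H_{\beta\beta}=A_{RL}^\top R_{\mathcal T}A_{RL},\quad H=\begin{pmatrix} H_{\alpha\alpha} & H_{\alpha\beta} \\ -H_{\alpha\beta}^\top & H_{\beta\beta} \end{pmatrix}.$$ Suppose that: 1) $G_{\mathrm m}:=\min_{i=1,\dots,n_\Phi}G_{mi}>|\mu(H_{\alpha\alpha})|$, where $\mu(H_{\alpha\alpha})$ is the least eigenvalue of the symmetric matrix $H_{\alpha\alpha}$; 2) the symmetric matrix $H_{\beta\beta}$ is positive definite; 3) $\|L^{1/2}H_{\beta\beta}^{-1}H_{\alpha\beta}^\top C^{-1/2}\|_2<1$, where $\|\cdot\|_2$ is the spectral norm. Consider the state equations in the voltage-current domain, with state $(v_C,i_L,\Phi_M)\in\mathbb R^{n_C}\times\mathbb R^{n_L}\times\mathbb R^{n_C}$, $$\begin{pmatrix} C\dot v_C \\ L\dot i_L \end{pmatrix}=-H\begin{pmatrix} v_C \\ i_L \end{pmatrix}-\begin{pmatrix} \hat Q_{MC}'(\Phi_M)v_C \\ 0 \end{pmatrix},\qquad\dot\Phi_M=v_C,\tag{V}$$ where $\hat Q_{MC}'(\Phi_M)=\mathrm{diag}(\hat Q_{M1}'(\Phi_{M1}),\dots,\hat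 Q_{Mn_C}'(\Phi_{Mn_C}))$, and let $\mathcal E$ be its set of equilibrium points. Then any solution of (V) (in the sense specified in the context) is bounded and converges to the set $\mathcal E$ as $t\to+\infty$; moreover, $v_C$ and $i_L$ converge to $0$. If, for given initial conditions $w_0=(v_{C0},i_{L0},\Phi_{M0})$, the equilibrium points of the corresponding system in the flux-charge domain $$\begin{pmatrix} C\dot\varphi_C \\ L\dot q_L \end{pmatrix}=-H\begin{pmatrix} \varphi_C \\ q_L \end{pmatrix}-\begin{pmatrix} \hat Q_{MC}(\varphi_C+\Phi_{M0})-\hat Q_{MC}(\Phi_{M0}) \\ 0 \end{pmatrix}+\begin{pmatrix} C v_{C0} \\ L i_{L0} \end{pmatrix}\tag{F}$$ are isolated, then the solution of (V) with initial conditions $w_0$ at $t=0$ converges to a single point $(0,0,\bar\Phi_M)\in\mathcal E$.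
   Context: Circuit. A connected digraph whose branches are: $n_C$ capacitive branches, each consisting of a capacitor $C_i>0$ in parallel with a flux-controlled memristor with characteristic $\hat Q_{Mi}:\mathbb R\to\mathbb R$; $n_L$ inductive branches, each a single inductor $L_i>0$; and linear resistors with resistances $R_i\ne0$ of either sign. Topological assumption. There is a spanning tree $\mathcal T$ with co-tree $\mathcal L$ such that all capacitive branches belong to $\mathcal T$ and the other branches of $\mathcal T$ are resistors; all inductive branches belong to $\mathcal L$ and the other branches of $\mathcal L$ are resistors; each resistor in $\mathcal L$ forms a (fundamental) loop exclusively with capacitive branches. Matrices. Kirchhoff's charge law for the fundamental cut-sets reads $q_{\mathcal T}+Aq_{\mathcal L}=0$, where $q_{\mathcal T},q_{\mathcal L}$ are the tree and co-tree branch charges and $A$ has entries in $\{-1,0,1\}$. Partition $A=\begin{pmatrix} A_{CL} & A_{CR} \\ A_{RL} & A_{RR} \end{pmatrix}$, with rows split into capacitive tree branches and tree resistors, and columns split into inductive co-tree branches and co-tree resistors (under the topological assumption $A_{RR}=0$). $R_{\mathcal T}$, $R_{\mathcal L}$ are the diagonal matrices of the resistances of the resistors in $\mathcal T$, $\mathcal L$; $C=\mathrm{diag}(C_1,\dots,C_{n_C})$, $L=\mathrm{diag}(L_1,\dots,L_{n_L})$; $\hat Q_{MC}(x)=(\hat Q_{M1}(x_1),\dots,\hat Q_{Mn_C}(x_{n_C}))$. Memristor assumption. For each $i$: $\hat Q_{Mi}\in C^1(\mathbb R)$, $\hat Q_{Mi}(0)=0$, $\hat Q_{Mi}'\ge0$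 everywhere, and $G_{mi}>0$, $\tilde\Phi_{Mi}>0$ are constants such that $\hat Q_{Mi}(\Phi)/\Phi\ge G_{mi}$ for $|\Phi|>\tilde\Phi_{Mi}$. Relation between the two domains. System (V) is obtained by differentiating (F) in time, with $v_C=\dot\varphi_C$, $i_L=\dot q_L$, $\Phi_M=\varphi_C+\Phi_{M0}$; the solution of (V) with $(v_C,i_L,\Phi_M)(0)=(v_{C0},i_{L0},\Phi_{M0})$ corresponds to the solution of (F) with $\varphi_C(0)=0$, $q_L(0)=0$, where $\varphi_C(t)=\int_0^tv_C$ and $q_L(t)=\int_0^ti_L$. A solution of (V) is a $C^1$ function satisfying (V), with arbitrary initial conditions at $t=0$. Convergence of a solution to a set means that its distance from the set tends to $0$ as $t\to+\infty$. *)

theory Defs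
  imports "Graph_Theory.Digraph_Component" "HOL-Analysis.Analysis"
begin

section \<open>Digraphs: loops, spanning trees, fundamental cut-sets\<close>

text \<open>
  The circuit graph is directed only to fix reference directions, so loops and trees must disregard
  the orientation of the arcs. The constants \<open>forest\<close>, \<open>tree\<close> and
  \<open>spanning_tree\<close> of \<^theory>\<open>Graph_Theory.Digraph_Component\<close> only exclude directed cycles
  and are therefore not usable here. An arc \<open>e\<close> traversed backwards is represented by \<open>(e, False)\<close>.
\<close>

definition traversals :: "('v, 'e) pre_digraph \<Rightarrow> ('v, 'e \<times> bool) pre_digraph" where
  "traversals G = \<lparr> verts = verts G, arcs = arcs G \<times> UNIV,
     tail = (\<lambda>(e, fwd). if fwd then tail G e else head G e),
     head = (\<lambda>(e, fwd). if fwd then head G e else tail G e) \<rparr>"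

text \<open>Distinctness of the arcs rules out going back and forth along one single arc.\<close>

definition loops :: "('v, 'e) pre_digraph \<Rightarrow> 'e set set" where
  "loops G = {fst ` set p | p. pre_digraph.cycle (traversals G) p \<and> distinct (map fst p)}"

definition is_spanning_tree :: "('v, 'e) pre_digraph \<Rightarrow> 'e set \<Rightarrow> bool" where
  "is_spanning_tree G T \<longleftrightarrow> T \<subseteq> arcs G
     \<and> Digraph_Component.connected (G\<lparr>arcs := T\<rparr>) \<and> loops (G\<lparr>arcs := T\<rparr>) = {}"

text \<open>
  The vertices that remain joined to the tail of the tree arc \<open>t\<close> when \<open>t\<close> is removed from \<open>T\<close>.
\<close>

definition tail_side :: "('v, 'e) pre_digraph \<Rightarrow> 'e set \<Rightarrow> 'e \<Rightarrow> 'v set" where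
  "tail_side G T t = {x. reachable (with_proj (mk_symmetric (G\<lparr>arcs := T - {t}\<rparr>))) (tail G t) x}"

text \<open>
  Entry of the matrix \<open>A\<close> in row \<open>t \<in> T\<close> and column \<open>l \<notin> T\<close>: the coefficient of the charge of \<open>l\<close>
  in Kirchhoff's law \<open>q\<^sub>T + A q\<^sub>L = 0\<close> for the fundamental cut-set of \<open>t\<close>, oriented along \<open>t\<close>.
\<close>

definition cutset_coeff :: "('v, 'e) pre_digraph \<Rightarrow> 'e set \<Rightarrow> 'e \<Rightarrow> 'e \<Rightarrow> real" where
  "cutset_coeff G T t l =
     (let S = tail_side G T t in
      if tail G l \<in> S \<and> head G l \<notin> S then 1
      else if tail G l \<notin> S \<and> head G l \<in> S then - 1
      else 0)"


section \<open>Matrices\<close>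

definition diag_mat :: "real ^ 'n \<Rightarrow> real ^ 'n ^ 'n" where
  "diag_mat d = (\<chi> i j. if i = j then d $ i else 0)"

definition is_eigenvalue :: "real ^ 'n ^ 'n \<Rightarrow> real \<Rightarrow> bool" where
  "is_eigenvalue M k \<longleftrightarrow> (\<exists>x. x \<noteq> 0 \<and> M *v x = k *\<^sub>R x)"

definition least_eigenvalue :: "real ^ 'n ^ 'n \<Rightarrow> real" where
  "least_eigenvalue M = (LEAST k. is_eigenvalue M k)"

definition positive_definite :: "real ^ 'n ^ 'n \<Rightarrow> bool" where
  "positive_definite M \<longleftrightarrow> transpose M = M \<and> (\<forall>x. x \<noteq> 0 \<longrightarrow> x \<bullet> (M *v x) > 0)"

definition spectral_norm :: "real ^ 'n ^ 'm \<Rightarrow> real" where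
  "spectral_norm M = onorm ((*v) M)"


section \<open>Circuits\<close>

text \<open>
  Capacitive branches (a capacitor with a flux-controlled memristor in parallel) are indexed by
  \<open>'c\<close> and inductive branches by \<open>'l\<close>; all remaining arcs are resistors. The sets of tree and
  co-tree resistors may be empty. The values of \<open>resistance\<close> on other branches are irrelevant.
\<close>

record ('v, 'e, 'c::finite, 'l::finite) circuit =
  graph :: "('v, 'e) pre_digraph"
  tree_arcs :: "'e set"
  cap_arc :: "'c \<Rightarrow> 'e"
  ind_arc :: "'l \<Rightarrow> 'e"
  capacitance :: "real ^ 'c"
  inductance :: "real ^ 'l"
  resistance :: "'e \<Rightarrow> real"
  mem_charge :: "'c \<Rightarrow> real \<Rightarrow> real"

definition tree_resistors :: "('v, 'e, 'c::finite, 'l::finite) circuit \<Rightarrow> 'e set" where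
  "tree_resistors N = tree_arcs N - range (cap_arc N)"

definition cotree_resistors :: "('v, 'e, 'c::finite, 'l::finite) circuit \<Rightarrow> 'e set" where
  "cotree_resistors N = arcs (graph N) - tree_arcs N - range (ind_arc N)"

definition RLCMa :: "('v, 'e, 'c::finite, 'l::finite) circuit \<Rightarrow> bool" where
  "RLCMa N \<longleftrightarrow>
     fin_digraph (graph N) \<and> Digraph_Component.connected (graph N)
     \<and> is_spanning_tree (graph N) (tree_arcs N)
     \<and> inj (cap_arc N) \<and> range (cap_arc N) \<subseteq> tree_arcs N
     \<and> inj (ind_arc N) \<and> range (ind_arc N) \<subseteq> arcs (graph N) - tree_arcs N
     \<and> (\<forall>l \<in> cotree_resistors N. \<forall>P \<in> loops (graph N).
          l \<in> P \<and> P \<subseteq> insert l (tree_arcs N) \<longrightarrow> P - {l} \<subseteq> range (cap_arc N))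
     \<and> (\<forall>i. capacitance N $ i > 0) \<and> (\<forall>j. inductance N $ j > 0)
     \<and> (\<forall>e \<in> tree_resistors N \<union> cotree_resistors N. resistance N e \<noteq> 0)"

definition memristor_assumption ::
  "('v, 'e, 'c::finite, 'l::finite) circuit \<Rightarrow> ('c \<Rightarrow> real) \<Rightarrow> ('c \<Rightarrow> real) \<Rightarrow> bool" where
  "memristor_assumption N Gm Phi_t \<longleftrightarrow>
     (\<forall>i. mem_charge N i C1_differentiable_on UNIV \<and> mem_charge N i 0 = 0
        \<and> (\<forall>x. deriv (mem_charge N i) x \<ge> 0)
        \<and> Gm i > 0 \<and> Phi_t i > 0
        \<and> (\<forall>x. \<bar>x\<bar> > Phi_t i \<longrightarrow> mem_charge N i x / x \<ge> Gm i))"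

abbreviation coeff_A :: "('v, 'e, 'c::finite, 'l::finite) circuit \<Rightarrow> 'e \<Rightarrow> 'e \<Rightarrow> real" where
  "coeff_A N \<equiv> cutset_coeff (graph N) (tree_arcs N)"

text \<open>
  The products \<open>A\<^sub>C\<^sub>R R\<^sub>L\<^sup>-\<^sup>1 A\<^sub>C\<^sub>R\<^sup>T\<close> and \<open>A\<^sub>R\<^sub>L\<^sup>T R\<^sub>T A\<^sub>R\<^sub>L\<close> are written entrywise, because their inner index
  sets, the co-tree and the tree resistors, may be empty and so cannot be types.
\<close>

definition H_aa :: "('v, 'e, 'c::finite, 'l::finite) circuit \<Rightarrow> real ^ 'c ^ 'c" where
  "H_aa N = (\<chi> i j. \<Sum>r \<in> cotree_resistors N.
     coeff_A N (cap_arc N i) r * inverse (resistance N r) * coeff_A N (cap_arc N j) r)"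

definition H_ab :: "('v, 'e, 'c::finite, 'l::finite) circuit \<Rightarrow> real ^ 'l ^ 'c" where
  "H_ab N = (\<chi> i j. coeff_A N (cap_arc N i) (ind_arc N j))"

definition H_bb :: "('v, 'e, 'c::finite, 'l::finite) circuit \<Rightarrow> real ^ 'l ^ 'l" where
  "H_bb N = (\<chi> j k. \<Sum>r \<in> tree_resistors N.
     coeff_A N r (ind_arc N j) * resistance N r * coeff_A N r (ind_arc N k))"

text \<open>The block matrix \<open>H\<close>, acting on the product space.\<close>

definition H_mult ::
  "('v, 'e, 'c::finite, 'l::finite) circuit \<Rightarrow> (real ^ 'c) \<times> (real ^ 'l) \<Rightarrow> (real ^ 'c) \<times> (real ^ 'l)" where
  "H_mult N = (\<lambda>(x, y). (H_aa N *v x + H_ab N *v y, - (transpose (H_ab N)) *v x + H_bb N *v y))"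

definition mem_charge_vec :: "('v, 'e, 'c::finite, 'l::finite) circuit \<Rightarrow> real ^ 'c \<Rightarrow> real ^ 'c" where
  "mem_charge_vec N x = (\<chi> i. mem_charge N i (x $ i))"

definition mem_deriv_mat :: "('v, 'e, 'c::finite, 'l::finite) circuit \<Rightarrow> real ^ 'c \<Rightarrow> real ^ 'c ^ 'c" where
  "mem_deriv_mat N x = diag_mat (\<chi> i. deriv (mem_charge N i) (x $ i))"


section \<open>State equations\<close>

type_synonym ('c, 'l) vi_state = "(real ^ 'c) \<times> (real ^ 'l) \<times> (real ^ 'c)"

text \<open>The system (V) as a relation between a state and its time derivative.\<close>

definition V_eqn ::
  "('v, 'e, 'c::finite, 'l::finite) circuit \<Rightarrow> ('c, 'l) vi_state \<Rightarrow> ('c, 'l) vi_state \<Rightarrow> bool" where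
  "V_eqn N = (\<lambda>(v, i, Phi) (dv, di, dPhi).
     (diag_mat (capacitance N) *v dv, diag_mat (inductance N) *v di)
       = - H_mult N (v, i) - (mem_deriv_mat N Phi *v v, 0)
     \<and> dPhi = v)"

definition equilibria_V :: "('v, 'e, 'c::finite, 'l::finite) circuit \<Rightarrow> ('c, 'l) vi_state set" where
  "equilibria_V N = {w. V_eqn N w 0}"

definition solution_V ::
  "('v, 'e, 'c::finite, 'l::finite) circuit \<Rightarrow> (real \<Rightarrow> ('c, 'l) vi_state) \<Rightarrow> bool" where
  "solution_V N w \<longleftrightarrow>
     (\<exists>w'. continuous_on {0..} w' \<and>
        (\<forall>t \<ge> 0. (w has_vector_derivative w' t) (at t within {0..}) \<and> V_eqn N (w t) (w' t)))"

text \<open>The system (F) belonging to the initial conditions \<open>(v0, i0, Phi0)\<close> of (V).\<close>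

definition F_eqn ::
  "('v, 'e, 'c::finite, 'l::finite) circuit \<Rightarrow> ('c, 'l) vi_state
    \<Rightarrow> (real ^ 'c) \<times> (real ^ 'l) \<Rightarrow> (real ^ 'c) \<times> (real ^ 'l) \<Rightarrow> bool" where
  "F_eqn N = (\<lambda>(v0, i0, Phi0) (phi, q) (dphi, dq).
     (diag_mat (capacitance N) *v dphi, diag_mat (inductance N) *v dq)
       = - H_mult N (phi, q)
         - (mem_charge_vec N (phi + Phi0) - mem_charge_vec N Phi0, 0)
         + (diag_mat (capacitance N) *v v0, diag_mat (inductance N) *v i0))"

definition equilibria_F ::
  "('v, 'e, 'c::finite, 'l::finite) circuit \<Rightarrow> ('c, 'l) vi_state \<Rightarrow> ((real ^ 'c) \<times> (real ^ 'l)) set" where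
  "equilibria_F N w0 = {z. F_eqn N w0 z 0}"

end

theory Submission
  imports Defs
begin

text \<open>
  Write \<open>M = H\<^sub>\<alpha>\<^sub>\<alpha>\<close>, \<open>B = H\<^sub>\<alpha>\<^sub>\<beta>\<close>, \<open>D = H\<^sub>\<beta>\<^sub>\<beta>\<close>. Setting \<open>q = D\<^sup>-\<^sup>1(B\<^sup>T \<Phi> - L i)\<close> makes \<open>q' = i\<close>, so (V) integrates to
  \<open>C v = c - M \<Phi> - B q - Q(\<Phi>)\<close> with a constant \<open>c\<close>; the inductor charge need not be introduced as an integral.
  As in the third theorem of Brayton and Moser, let \<open>V\<close> be
  \<open>\<Phi>\<^sup>T M \<Phi> / 2 + \<Sum>\<integral>Q + (B\<^sup>T\<Phi>)\<^sup>T D\<^sup>-\<^sup>1 (B\<^sup>T\<Phi>) / 2 - c\<^sup>T\<Phi> + (L i)\<^sup>T D\<^sup>-\<^sup>1 (L i) / 2\<close>.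
  Then \<open>V' = - v\<^sup>T C v - i\<^sup>T L i + 2 (L i)\<^sup>T D\<^sup>-\<^sup>1 B\<^sup>T v\<close>, and the norm condition gives \<open>V' \<le> - d |(v, i)|\<^sup>2\<close> with \<open>d > 0\<close>.
  Since the memristors grow faster than \<open>|\<mu>(M)|\<close>, \<open>V\<close> is coercive, so trajectories are bounded and
  \<open>(v, i)\<close>, being Lipschitz in time and square integrable, tends to \<open>0\<close>. Limit points of the
  flux-charge trajectory are then equilibria of (F), and a bounded trajectory whose limit points are
  isolated converges.
\<close>

section \<open>Rayleigh quotients of symmetric matrices\<close>

text \<open>The quadratic form attains its minimum \<open>m\<close> on the compact unit sphere, at
  some \<open>x\<close>. The residual \<open>u = A *v x - m *\<^sub>R x\<close> must vanish, since
  otherwise a short move from \<open>x\<close> along \<open>- u\<close> would push the Rayleigh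
  quotient below \<open>m\<close>.\<close>

lemma symmetric_matrix_least_Rayleigh:
  fixes A :: "real ^ 'n ^ 'n"
  assumes sym: "transpose A = A"
  obtains x m where "x \<noteq> 0" "A *v x = m *\<^sub>R x" "\<And>y. m * (norm y)\<^sup>2 \<le> y \<bullet> (A *v y)"
proof -
  have adj: "(A *v y) \<bullet> z = y \<bullet> (A *v z)" for y z
    by (metis dot_lmul_matrix sym transpose_matrix_vector)
  have "compact (sphere (0 :: real ^ 'n) 1)" by simp
  moreover have "sphere (0 :: real ^ 'n) 1 \<noteq> {}" by simp
  moreover have "continuous_on (sphere 0 1) (\<lambda>y. y \<bullet> (A *v y))"
    by (intro continuous_intros)
  ultimately obtain x where x: "x \<in> sphere 0 1"
    and min: "\<And>y. y \<in> sphere 0 1 \<Longrightarrow> x \<bullet> (A *v x) \<le> y \<bullet> (A *v y)"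
    using continuous_attains_inf by metis
  define m where "m = x \<bullet> (A *v x)"
  have bound: "m * (norm y)\<^sup>2 \<le> y \<bullet> (A *v y)" for y
  proof (cases "y = 0")
    case False
    let ?u = "inverse (norm y) *\<^sub>R y"
    have "m \<le> ?u \<bullet> (A *v ?u)"
      using min[of ?u] False by (simp add: m_def)
    also have "\<dots> = (y \<bullet> (A *v y)) / (norm y)\<^sup>2"
      by (simp add: scaleR_matrix_vector_assoc[symmetric] matrix_vector_mult_scaleR power2_eq_square field_simps)
    finally show ?thesis
      using False by (simp add: field_simps)
  qed simp
  define u where "u = A *v x - m *\<^sub>R x"
  \<comment> \<open>The bound is evaluated at \<open>x - s *\<^sub>R u\<close>. The terms with
    \<open>u \<bullet> x\<close> cancel, which leaves a term linear in \<open>s\<close> below a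
    quadratic one.\<close>
  have ineq: "2 * (u \<bullet> u) * s \<le> s\<^sup>2 * (u \<bullet> (A *v u) - m * (u \<bullet> u))" for s
  proof -
    have 1: "m * ((x - s *\<^sub>R u) \<bullet> (x - s *\<^sub>R u)) \<le> (x - s *\<^sub>R u) \<bullet> (A *v (x - s *\<^sub>R u))"
      using bound[of "x - s *\<^sub>R u"] by (simp add: power2_norm_eq_inner)
    have 2: "(x - s *\<^sub>R u) \<bullet> (A *v (x - s *\<^sub>R u))
      = m - 2 * s * (u \<bullet> (A *v x)) + s\<^sup>2 * (u \<bullet> (A *v u))"
      using adj[of x u]
      by (simp add: matrix_vector_mult_diff_distrib matrix_vector_mult_scaleR inner_diff inner_commute
          m_def algebra_simps power2_eq_square)
    have 3: "(x - s *\<^sub>R u) \<bullet> (x - s *\<^sub>R u) = 1 - 2 * s * (u \<bullet> x) + s\<^sup>2 * (u \<bullet> u)"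
      using x by (simp add: inner_diff inner_commute algebra_simps power2_eq_square norm_eq_1)
    have 4: "u \<bullet> (A *v x) = u \<bullet> u + m * (u \<bullet> x)"
      unfolding u_def by (simp add: inner_diff algebra_simps)
    show ?thesis using 1 unfolding 2 3 4 by (simp add: algebra_simps)
  qed
  have "u = 0"
  proof (rule ccontr)
    assume "u \<noteq> 0"
    define a b where "a = u \<bullet> u" and "b = u \<bullet> (A *v u) - m * (u \<bullet> u)"
    have a: "a > 0" using \<open>u \<noteq> 0\<close> by (simp add: a_def)
    \<comment> \<open>This \<open>s\<close> is so small that \<open>s * b \<le> a\<close>, against
      \<open>2 * a \<le> s * b\<close>; the summand 1 keeps the denominator positive when
      \<open>b = 0\<close>.\<close>
    define s where "s = a / (\<bar>b\<bar> + 1)"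
    have "s > 0" using a by (simp add: s_def add_nonneg_pos)
    moreover have "s * (2 * a) \<le> s * (s * b)"
      using ineq[of s] by (simp add: a_def b_def power2_eq_square algebra_simps)
    ultimately have "2 * a \<le> a / (\<bar>b\<bar> + 1) * b"
      unfolding s_def[symmetric] by (simp only: mult_le_cancel_left_pos)
    also have "\<dots> \<le> a / (\<bar>b\<bar> + 1) * (\<bar>b\<bar> + 1)"
      using a by (intro mult_left_mono) auto
    also have "\<dots> = a" by simp
    finally show False using a by simp
  qed
  show thesis
    by (rule that[of x m]) (use x bound \<open>u = 0\<close> in \<open>auto simp: u_def\<close>)
qed

text \<open>A \<open>LEAST\<close> over the reals is meaningful only once a minimum is exhibited.
  The Rayleigh minimum is an eigenvalue, and testing its bound on any other eigenvector shows that
  it is the least one.\<close>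

lemma least_eigenvalue_le:
  fixes A :: "real ^ 'n ^ 'n"
  assumes "transpose A = A"
  shows "least_eigenvalue A * (norm y)\<^sup>2 \<le> y \<bullet> (A *v y)"
proof -
  obtain x m where x: "x \<noteq> 0" "A *v x = m *\<^sub>R x"
    and m: "\<And>y. m * (norm y)\<^sup>2 \<le> y \<bullet> (A *v y)"
    using symmetric_matrix_least_Rayleigh[OF assms] by metis
  have "least_eigenvalue A = m"
    unfolding least_eigenvalue_def
  proof (rule Least_equality)
    show "is_eigenvalue A m" using x by (auto simp: is_eigenvalue_def)
    fix k assume "is_eigenvalue A k"
    then obtain z where z: "z \<noteq> 0" "A *v z = k *\<^sub>R z" by (auto simp: is_eigenvalue_def)
    then show "m \<le> k" using m[of z] by (simp add: power2_norm_eq_inner)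
  qed
  then show ?thesis using m by simp
qed

text \<open>The constant is the Rayleigh minimum, which is positive because it is attained at a
  nonzero vector.\<close>

lemma positive_definite_coercive:
  assumes "positive_definite A"
  obtains a where "a > 0" "\<And>y. a * (norm y)\<^sup>2 \<le> y \<bullet> (A *v y)"
proof -
  obtain x m where x: "x \<noteq> 0" "A *v x = m *\<^sub>R x"
    and m: "\<And>y. m * (norm y)\<^sup>2 \<le> y \<bullet> (A *v y)"
    using symmetric_matrix_least_Rayleigh assms unfolding positive_definite_def by metis
  have "0 < x \<bullet> (A *v x)" using assms x by (auto simp: positive_definite_def)
  then have "m > 0" using x by (simp add: zero_less_mult_iff inner_ge_zero leD)
  then show thesis using m that by blast
qed

section \<open>Asymptotics of functions on the half line\<close>

lemma mean_value_half_line: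
  fixes V V' :: "real \<Rightarrow> real"
  assumes deriv: "\<And>t. t \<ge> 0 \<Longrightarrow> (V has_vector_derivative V' t) (at t within {0..})"
    and "0 \<le> s" "s \<le> t"
  shows "\<exists>x\<in>{s..t}. V t - V s = (t - s) * V' x"
proof -
  have "(V has_derivative (\<lambda>h. h *\<^sub>R V' x)) (at x within {s..t})" if "s \<le> x" "x \<le> t" for x
    using deriv[of x] \<open>0 \<le> s\<close> that unfolding has_vector_derivative_def
    by (auto intro: has_derivative_subset)
  then show ?thesis using mvt_very_simple[OF \<open>s \<le> t\<close>, of V "\<lambda>x h. h *\<^sub>R V' x"] by auto
qed

lemma nonpos_derivative_antimono_half_line:
  fixes V V' :: "real \<Rightarrow> real"
  assumes deriv: "\<And>t. t \<ge> 0 \<Longrightarrow> (V has_vector_derivative V' t) (at t within {0..})"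
    and "\<And>t. t \<ge> 0 \<Longrightarrow> V' t \<le> 0"
    and "0 \<le> s" "s \<le> t"
  shows "V t \<le> V s"
  using mean_value_half_line[of V V' s t] assms
  by (smt (verit) atLeastAtMost_iff mult_nonneg_nonpos)

text \<open>An argument of Barbalat type. If \<open>g\<close> has norm at least \<open>e\<close> at
  some time, the Lipschitz bound keeps it above \<open>e / 2\<close> for a fixed duration, and this
  costs \<open>V\<close> a fixed amount. Such a loss is impossible once \<open>V\<close> is closer
  than that amount to its infimum.\<close>

lemma dissipation_tendsto_zero:
  fixes V V' :: "real \<Rightarrow> real" and g :: "real \<Rightarrow> 'a::real_normed_vector"
  assumes deriv: "\<And>t. t \<ge> 0 \<Longrightarrow> (V has_vector_derivative V' t) (at t within {0..})"
    and dissip: "\<And>t. t \<ge> 0 \<Longrightarrow> V' t \<le> - d * (norm (g t))\<^sup>2" and "d > 0"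
    and below: "\<And>t. t \<ge> 0 \<Longrightarrow> b \<le> V t"
    and lip: "\<And>s t. 0 \<le> s \<Longrightarrow> s \<le> t \<Longrightarrow> norm (g t - g s) \<le> K * (t - s)"
  shows "(g \<longlongrightarrow> 0) at_top"
proof -
  have mvt: "\<exists>x\<in>{s..t}. V t - V s = (t - s) * V' x" if "0 \<le> s" "s \<le> t" for s t
    using mean_value_half_line[of V V' s t] deriv that by blast
  have V'_nonpos: "V' t \<le> 0" if "t \<ge> 0" for t
    using dissip[OF that] \<open>d > 0\<close> by (smt (verit) mult_nonneg_nonneg mult_minus_left zero_le_power2)
  have anti: "V t \<le> V s" if "0 \<le> s" "s \<le> t" for s t
    using nonpos_derivative_antimono_half_line[of V V' s t] deriv V'_nonpos that by blast
  define I where "I = Inf (V ` {0..})"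
  have bdd: "bdd_below (V ` {0..})" using below by (auto simp: bdd_below_def)
  have I_le: "I \<le> V t" if "t \<ge> 0" for t
    unfolding I_def using bdd that by (auto intro: cInf_lower)
  have "K \<ge> 0" using order_trans[OF norm_ge_zero lip[of 0 1]] by simp
  show ?thesis
  proof (rule tendstoI)
    fix e :: real assume "e > 0"
    \<comment> \<open>A duration in which \<open>g\<close> moves by at most \<open>e / 2\<close>;
      using \<open>K + 1\<close> covers the case \<open>K = 0\<close>.\<close>
    define \<tau> where "\<tau> = e / (2 * (K + 1))"
    have \<tau>: "\<tau> > 0" "K * \<tau> \<le> e / 2"
      using \<open>e > 0\<close> \<open>K \<ge> 0\<close> by (auto simp: \<tau>_def field_simps)
    \<comment> \<open>The loss of \<open>V\<close> over a time \<tau> during which the norm of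
      \<open>g\<close> stays above \<open>e / 2\<close>.\<close>
    define \<eta> where "\<eta> = d * (e / 2)\<^sup>2 * \<tau>"
    have "\<eta> > 0" using \<tau> \<open>d > 0\<close> \<open>e > 0\<close> by (simp add: \<eta>_def)
    have "\<exists>T\<ge>0. V T < I + \<eta>"
    proof -
      have "I < I + \<eta>" using \<open>\<eta> > 0\<close> by simp
      then obtain y where "y \<in> V ` {0..}" "y < I + \<eta>"
        unfolding I_def using cInf_lessD[of "V ` {0..}" "Inf (V ` {0..}) + \<eta>"] by auto
      then show ?thesis by auto
    qed
    then obtain T where T: "T \<ge> 0" "V T < I + \<eta>" by blast
    have "norm (g t) < e" if "t \<ge> T" for t
    proof (rule ccontr)
      assume big: "\<not> norm (g t) < e"
      have t: "t \<ge> 0" using that T by simp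
      obtain x where x: "x \<in> {t..t + \<tau>}" "V (t + \<tau>) - V t = \<tau> * V' x"
        using mvt[of t "t + \<tau>"] t \<tau> by auto
      have "norm (g x - g t) \<le> K * (x - t)" using lip[of t x] x t by auto
      also have "\<dots> \<le> K * \<tau>" using x \<open>K \<ge> 0\<close> by (intro mult_left_mono) auto
      finally have "norm (g x - g t) \<le> e / 2" using \<tau> by linarith
      then have "e / 2 \<le> norm (g x)"
        using big norm_triangle_ineq2[of "g t" "g x"] by (simp add: norm_minus_commute)
      then have "(e / 2)\<^sup>2 \<le> (norm (g x))\<^sup>2" using \<open>e > 0\<close> by (intro power_mono) auto
      then have "V' x \<le> - d * (e / 2)\<^sup>2"
        using dissip[of x] x t \<open>d > 0\<close> by (smt (verit) atLeastAtMost_iff mult_left_mono mult_minus_left)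
      then have "V (t + \<tau>) - V t \<le> - \<eta>"
        using x \<tau> mult_left_mono[of "V' x" "- d * (e / 2)\<^sup>2" \<tau>] by (simp add: \<eta>_def algebra_simps)
      moreover have "V t \<le> V T" using anti T that by blast
      moreover have "I \<le> V (t + \<tau>)" using I_le t \<tau> by simp
      ultimately show False using T by linarith
    qed
    then show "\<forall>\<^sub>F t in at_top. dist (g t) 0 < e"
      by (auto simp: eventually_at_top_linorder)
  qed
qed

text \<open>A trajectory that leaves a small ball around a limit point infinitely often
  accumulates on its boundary sphere, away from all other limit points.\<close>

lemma tendsto_of_discrete_limit_points:
  fixes z :: "real \<Rightarrow> 'a::heine_borel"
  assumes cont: "continuous_on {0..} z" and bdd: "bounded (z ` {0..})"
    and lim: "\<And>s l. filterlim s at_top sequentially \<Longrightarrow> (\<lambda>n. z (s n)) \<longlonglongrightarrow> l \<Longrightarrow> l \<in> E"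
    and disc: "discrete E"
  obtains l where "l \<in> E" "(z \<longlongrightarrow> l) at_top"
proof -
  have sub: "\<exists>l r. l \<in> E \<and> strict_mono r \<and> (\<lambda>n. z (s (r n))) \<longlonglongrightarrow> l"
    if s: "filterlim s at_top sequentially" "\<And>n. s n \<ge> (0::real)" for s :: "nat \<Rightarrow> real"
  proof -
    have "bounded (range (\<lambda>n. z (s n)))"
      by (rule bounded_subset[OF bdd]) (use s in auto)
    then obtain l r where lr: "strict_mono (r :: nat \<Rightarrow> nat)" "((\<lambda>n. z (s n)) \<circ> r) \<longlonglongrightarrow> l"
      using bounded_imp_convergent_subsequence by blast
    have "filterlim (\<lambda>n. s (r n)) at_top sequentially"
      by (rule filterlim_compose[OF s(1) filterlim_subseq[OF lr(1)]])
    with lr lim[of "\<lambda>n. s (r n)" l] show ?thesis by (auto simp: o_def)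
  qed
  obtain l r where l: "l \<in> E" and r: "strict_mono r" "(\<lambda>n. z (real (r n))) \<longlonglongrightarrow> l"
    using sub[OF filterlim_real_sequentially] by auto
  obtain e0 where e0: "e0 > 0" "\<And>y. y \<in> E \<Longrightarrow> dist l y < e0 \<Longrightarrow> y = l"
    using discreteD[OF disc l] unfolding isolated_in_dist_Ex_iff by blast
  have "(z \<longlongrightarrow> l) at_top"
  proof (rule tendstoI)
    fix e :: real assume "e > 0"
    \<comment> \<open>Below \<open>e\<close>, so the sphere of this radius is crossed before
      distance \<open>e\<close> is reached; below \<open>e0\<close>, so the sphere contains no point
      of \<open>E\<close>.\<close>
    define \<rho> where "\<rho> = min e e0 / 2"
    have \<rho>: "\<rho> > 0" "\<rho> < e" "\<rho> < e0" using \<open>e > 0\<close> e0 by (auto simp: \<rho>_def)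
    show "\<forall>\<^sub>F t in at_top. dist (z t) l < e"
    proof (rule ccontr)
      assume nev: "\<not> (\<forall>\<^sub>F t in at_top. dist (z t) l < e)"
      \<comment> \<open>After time \<open>n\<close> the trajectory is first closer to
        \<open>l\<close> than \<rho> and later at distance at least \<open>e\<close>, so the
        intermediate value theorem gives a time at distance exactly \<rho>.\<close>
      have "\<exists>s. s \<ge> real n \<and> dist (z s) l = \<rho>" for n :: nat
      proof -
        have "\<forall>\<^sub>F k in sequentially. dist (z (real (r k))) l < \<rho>"
          using r(2) \<rho> by (auto dest: tendstoD)
        moreover have "\<forall>\<^sub>F k in sequentially. r k \<ge> n"
          using filterlim_subseq[OF r(1)] by (simp add: filterlim_at_top)
        ultimately obtain k where k: "dist (z (real (r k))) l < \<rho>" "r k \<ge> n"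
          using eventually_happens'[OF sequentially_bot eventually_conj] by blast
        obtain t where t: "t \<ge> real (r k)" "dist (z t) l \<ge> e"
          using nev unfolding eventually_at_top_linorder by (meson not_less)
        have "continuous_on {real (r k)..t} (\<lambda>s. dist (z s) l)"
          by (intro continuous_intros continuous_on_subset[OF cont]) auto
        then obtain s where "real (r k) \<le> s" "dist (z s) l = \<rho>"
          using IVT'[of "\<lambda>s. dist (z s) l" "real (r k)" \<rho> t] k t \<rho> by auto
        then show ?thesis using k by (intro exI[of _ s]) auto
      qed
      then obtain s where s: "\<And>n. s n \<ge> real n" "\<And>n. dist (z (s n)) l = \<rho>" by metis
      have "filterlim s at_top sequentially"
        by (rule filterlim_at_top_mono[OF filterlim_real_sequentially]) (use s in auto)
      moreover have "s n \<ge> 0" for n using s(1)[of n] by linarith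
      ultimately obtain y q where y: "y \<in> E" "(\<lambda>n. z (s (q n))) \<longlonglongrightarrow> y"
        using sub by metis
      have "(\<lambda>n. dist (z (s (q n))) l) \<longlonglongrightarrow> dist y l"
        by (intro tendsto_intros y)
      then have "dist y l = \<rho>" using s(2) by (simp add: LIMSEQ_const_iff)
      then show False using e0(2)[OF y(1)] \<rho> by (auto simp: dist_commute)
    qed
  qed
  with l that show thesis by blast
qed

section \<open>Antiderivatives and their growth\<close>

lemma continuous_has_antiderivative:
  fixes f :: "real \<Rightarrow> real"
  assumes "continuous_on UNIV f"
  obtains F where "\<And>x. (F has_real_derivative f x) (at x)"
proof -
  have "\<exists>F. \<forall>x :: real. -\<infinity> < ereal x \<longrightarrow> ereal x < \<infinity> \<longrightarrow> (F has_vector_derivative f x) (at x)"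
    by (rule einterval_antiderivative)
       (use assms in \<open>auto simp: continuous_on_eq_continuous_at\<close>)
  then show thesis using that by (auto simp: has_real_derivative_iff_has_vector_derivative)
qed

text \<open>The difference of \<open>F\<close> and the parabola has derivative
  \<open>Q x - g * x\<close>, which is nonnegative to the right of \<open>r\<close> and nonpositive
  to the left of \<open>-r\<close>. Its minimum over the compact interval between is therefore
  global.\<close>

lemma antiderivative_quadratic_lower_bound:
  fixes Q F :: "real \<Rightarrow> real"
  assumes F: "\<And>x. (F has_real_derivative Q x) (at x)"
    and growth: "\<And>x. \<bar>x\<bar> > r \<Longrightarrow> Q x / x \<ge> g" and "r > 0"
  obtains k where "\<And>x. F x \<ge> g / 2 * x\<^sup>2 - k"
proof -
  define h where "h x = F x - g / 2 * x\<^sup>2" for x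
  have h: "(h has_real_derivative Q x - g * x) (at x)" for x
    unfolding h_def by (auto intro!: derivative_eq_intros F)
  have "continuous_on {-r..r} h"
    using h by (meson DERIV_isCont continuous_at_imp_continuous_on)
  then obtain p where p: "\<And>x. x \<in> {-r..r} \<Longrightarrow> h p \<le> h x"
    using continuous_attains_inf[of "{-r..r}" h] \<open>r > 0\<close>
    by (metis atLeastatMost_empty_iff compact_Icc less_eq_real_def neg_le_0_iff_le order_trans)
  have "h p \<le> h x" for x
  proof -
    consider "x \<in> {-r..r}" | "x > r" | "x < -r" by fastforce
    then show ?thesis
    proof cases
      case 2
      have "h r \<le> h x"
      proof (rule DERIV_nonneg_imp_increasing_open[of r x h])
        fix y assume "r < y" "y < x"
        then show "\<exists>d. (h has_real_derivative d) (at y) \<and> d \<ge> 0"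
          using h[of y] growth[of y] \<open>r > 0\<close> by (intro exI[of _ "Q y - g * y"]) (auto simp: field_simps)
      qed (use 2 h in \<open>auto intro!: continuous_at_imp_continuous_on DERIV_isCont\<close>)
      then show ?thesis using p[of r] \<open>r > 0\<close> by auto
    next
      case 3
      have "h (-r) \<le> h x"
      proof (rule DERIV_nonpos_imp_decreasing_open[of x "-r" h])
        fix y assume "x < y" "y < -r"
        then show "\<exists>d. (h has_real_derivative d) (at y) \<and> d \<le> 0"
          using h[of y] growth[of y] \<open>r > 0\<close> by (intro exI[of _ "Q y - g * y"]) (auto simp: field_simps)
      qed (use 3 h in \<open>auto intro!: continuous_at_imp_continuous_on DERIV_isCont\<close>)
      then show ?thesis using p[of "-r"] \<open>r > 0\<close> by auto
    qed (use p in auto)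
  qed
  then show thesis
    using that[of "- h p"] by (auto simp: h_def algebra_simps)
qed

section \<open>Positive definite matrices and calculus of vector functions\<close>

lemma diag_mat_mult_vec: "diag_mat d *v x = (\<chi> i. d $ i * x $ i)"
proof -
  have "(if i = j then d $ i else 0) * x $ j = (if i = j then d $ i * x $ i else 0)" for i j
    by simp
  then show ?thesis by (simp add: diag_mat_def matrix_vector_mult_def)
qed

lemma positive_definite_diag_mat:
  assumes "\<And>i. d $ i > 0"
  shows "positive_definite (diag_mat d)"
  unfolding positive_definite_def
proof (intro conjI allI impI)
  show "transpose (diag_mat d) = diag_mat d"
    by (simp add: diag_mat_def transpose_def vec_eq_iff)
  fix x :: "real ^ 'a" assume "x \<noteq> 0"
  then obtain i where "x $ i \<noteq> 0" by (auto simp: vec_eq_iff)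
  then have "d $ i * (x $ i)\<^sup>2 > 0" using assms by simp
  then have "(\<Sum>i\<in>UNIV. d $ i * (x $ i)\<^sup>2) > 0"
    by (intro sum_pos2[of _ i]) (use assms in \<open>auto simp: less_imp_le\<close>)
  then show "x \<bullet> (diag_mat d *v x) > 0"
    by (simp add: diag_mat_mult_vec inner_vec_def power2_eq_square mult.left_commute)
qed

lemma has_vector_derivative_vec_lambda:
  fixes f :: "'n::finite \<Rightarrow> real \<Rightarrow> real"
  assumes "\<And>j. (f j has_vector_derivative f' j) F"
  shows "((\<lambda>t. \<chi> j. f j t) has_vector_derivative (\<chi> j. f' j)) F"
proof -
  have eq: "(\<chi> j. a j) = (\<Sum>j\<in>UNIV. a j *\<^sub>R axis j 1)" for a :: "'n \<Rightarrow> real"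
    by (simp add: vec_eq_iff axis_def if_distrib cong: if_cong)
  show ?thesis unfolding eq
    by (intro has_vector_derivative_sum bounded_linear.has_vector_derivative[OF bounded_linear_scaleR_left] assms)
qed

lemma has_vector_derivative_matrix_vector_mult:
  fixes A :: "real ^ 'n ^ 'm"
  shows "(f has_vector_derivative f') F \<Longrightarrow> ((\<lambda>t. A *v f t) has_vector_derivative A *v f') F"
  by (rule bounded_linear.has_vector_derivative[OF matrix_vector_mul_bounded_linear])

lemma continuous_on_matrix_vector_mult:
  fixes A :: "real ^ 'n ^ 'm"
  shows "continuous_on S f \<Longrightarrow> continuous_on S (\<lambda>x. A *v f x)"
  by (rule bounded_linear.continuous_on[OF matrix_vector_mul_bounded_linear])

lemma bounded_continuous_image_UNIV:
  fixes f :: "'a::heine_borel \<Rightarrow> 'b::metric_space"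
  assumes "continuous_on UNIV f" "bounded S"
  shows "bounded (f ` S)"
proof -
  have "compact (f ` closure S)"
    using assms by (intro compact_continuous_image) (auto intro: continuous_on_subset)
  then show ?thesis
    by (meson bounded_subset closure_subset compact_imp_bounded image_mono)
qed

lemma bounded_norm_squareI:
  fixes f :: "real \<Rightarrow> 'a::real_normed_vector"
  assumes "a > 0" "\<And>t. t \<ge> 0 \<Longrightarrow> a * (norm (f t))\<^sup>2 \<le> b"
  shows "bounded (f ` {0..})"
proof (rule boundedI)
  fix y assume "y \<in> f ` {0..}"
  then have "(norm y)\<^sup>2 \<le> b / a" using assms by (auto simp: field_simps)
  then show "norm y \<le> sqrt (b / a)" by (rule real_le_rsqrt)
qed

text \<open>\<open>matrix_inv\<close> is a choice, so its identities come from invertibility, which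
  holds because the kernel is trivial. Definiteness carries over through the substitution
  \<open>x = A *v y\<close>.\<close>

lemma positive_definite_matrix_inv:
  fixes A :: "real ^ 'n ^ 'n"
  assumes pd: "positive_definite A"
  shows "A ** matrix_inv A = mat 1" "matrix_inv A ** A = mat 1" "positive_definite (matrix_inv A)"
proof -
  have "\<forall>x. A *v x = 0 \<longrightarrow> x = 0"
    using pd unfolding positive_definite_def by (metis inner_zero_right less_irrefl)
  then have "invertible A"
    by (simp add: invertible_left_inverse matrix_left_invertible_ker)
  then have inv: "A ** matrix_inv A = mat 1 \<and> matrix_inv A ** A = mat 1"
    unfolding invertible_def matrix_inv_def by (rule someI_ex)
  then show "A ** matrix_inv A = mat 1" "matrix_inv A ** A = mat 1" by auto
  have sym: "transpose A = A" using pd by (simp add: positive_definite_def)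
  have "transpose (matrix_inv A) ** A = mat 1"
    using inv sym by (metis matrix_transpose_mul transpose_mat)
  then have tr: "transpose (matrix_inv A) = matrix_inv A"
    using inv by (metis matrix_mul_assoc matrix_mul_lid matrix_mul_rid)
  show "positive_definite (matrix_inv A)"
    unfolding positive_definite_def
  proof (intro conjI allI impI)
    fix x :: "real ^ 'n" assume "x \<noteq> 0"
    have x: "A *v (matrix_inv A *v x) = x" using inv by (simp add: matrix_vector_mul_assoc)
    then have "matrix_inv A *v x \<noteq> 0" using \<open>x \<noteq> 0\<close> by auto
    then have "(matrix_inv A *v x) \<bullet> (A *v (matrix_inv A *v x)) > 0"
      using pd by (simp add: positive_definite_def)
    then show "x \<bullet> (matrix_inv A *v x) > 0" using x by (simp add: inner_commute)
  qed (rule tr)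
qed

lemma inner_transpose_mult:
  fixes A :: "real ^ 'n ^ 'm"
  shows "(transpose A *v x) \<bullet> y = x \<bullet> (A *v y)"
  by (simp add: dot_lmul_matrix)

text \<open>Symmetry makes the two terms of the product rule equal, hence the factor 2.\<close>

lemma has_vector_derivative_quadratic_form:
  fixes A :: "real ^ 'n ^ 'n"
  assumes sym: "transpose A = A" and f: "(f has_vector_derivative f') (at t within S)"
  shows "((\<lambda>t. f t \<bullet> (A *v f t)) has_vector_derivative 2 * (f' \<bullet> (A *v f t))) (at t within S)"
proof -
  have "f t \<bullet> (A *v f') = f' \<bullet> (A *v f t)"
    using inner_transpose_mult[of A "f t" f'] by (simp add: sym inner_commute)
  then show ?thesis
    using bounded_bilinear.has_vector_derivative[OF bounded_bilinear_inner f
        has_vector_derivative_matrix_vector_mult[OF f, of A]] by simp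
qed

lemma uminus_matrix_vector_mult:
  fixes A :: "real ^ 'n ^ 'm"
  shows "(- A) *v x = - (A *v x)"
  by (simp add: matrix_vector_mult_def vec_eq_iff sum_negf)

declare transpose_matrix_vector [simp del]

section \<open>A single trajectory of the state equations\<close>

text \<open>The circuit is replaced by its matrices. Here \<open>m\<close> stands for the absolute
  value of the least eigenvalue of \<open>M\<close>, \<open>g\<close> for the smallest memristor
  slope and \<open>r\<close> for the thresholds beyond which that slope is guaranteed.\<close>

locale memristor_trajectory =
  fixes M :: "real ^ 'c ^ 'c" and B :: "real ^ 'l ^ 'c" and D :: "real ^ 'l ^ 'l"
    and cap :: "real ^ 'c" and ind :: "real ^ 'l"
    and Q Q' :: "'c \<Rightarrow> real \<Rightarrow> real" and r :: "'c \<Rightarrow> real" and m g :: real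
    and v \<Phi> v' :: "real \<Rightarrow> real ^ 'c" and i i' :: "real \<Rightarrow> real ^ 'l"
  assumes M_sym: "transpose M = M"
    and M_lower: "\<And>x. - m * (norm x)\<^sup>2 \<le> x \<bullet> (M *v x)"
    and D_pd: "positive_definite D"
    and cap_pos: "\<And>j. cap $ j > 0" and ind_pos: "\<And>j. ind $ j > 0"
    and contraction: "spectral_norm (diag_mat (\<chi> j. sqrt (ind $ j)) ** matrix_inv D
           ** transpose B ** diag_mat (\<chi> j. 1 / sqrt (cap $ j))) < 1"
    and Q_deriv: "\<And>j x. (Q j has_real_derivative Q' j x) (at x)"
    and Q'_cont: "\<And>j. continuous_on UNIV (Q' j)"
    and growth: "\<And>j x. \<bar>x\<bar> > r j \<Longrightarrow> Q j x / x \<ge> g"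
    and r_pos: "\<And>j. r j > 0"
    and m_less: "m < g"
    and v_deriv: "\<And>t. t \<ge> 0 \<Longrightarrow> (v has_vector_derivative v' t) (at t within {0..})"
    and i_deriv: "\<And>t. t \<ge> 0 \<Longrightarrow> (i has_vector_derivative i' t) (at t within {0..})"
    and \<Phi>_deriv: "\<And>t. t \<ge> 0 \<Longrightarrow> (\<Phi> has_vector_derivative v t) (at t within {0..})"
    and eq_v: "\<And>t. t \<ge> 0 \<Longrightarrow> diag_mat cap *v v' t
                 = - (M *v v t) - B *v i t - (\<chi> j. Q' j (\<Phi> t $ j) * v t $ j)"
    and eq_i: "\<And>t. t \<ge> 0 \<Longrightarrow> diag_mat ind *v i' t = transpose B *v v t - D *v i t"
begin

abbreviation "C \<equiv> diag_mat cap"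
abbreviation "L \<equiv> diag_mat ind"
abbreviation "Dinv \<equiv> matrix_inv D"

text \<open>This charge differs from the integral of \<open>i\<close> by the constant
  \<open>q 0\<close>, so the charge variable of (F) is \<open>q t - q 0\<close>.\<close>

definition q :: "real \<Rightarrow> real ^ 'l" where
  "q t = Dinv *v (transpose B *v \<Phi> t - L *v i t)"

definition Qv :: "real ^ 'c \<Rightarrow> real ^ 'c" where "Qv x = (\<chi> j. Q j (x $ j))"

lemma Q_cont: "continuous_on UNIV (Q j)"
  using Q_deriv by (meson DERIV_isCont continuous_at_imp_continuous_on)

lemma Qv_cont: "continuous_on UNIV Qv"
  unfolding Qv_def[abs_def] by (intro continuous_intros continuous_on_compose2[OF Q_cont]) auto

lemma C_pd: "positive_definite C" and L_pd: "positive_definite L"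
  using cap_pos ind_pos by (simp_all add: positive_definite_diag_mat)

lemma C_cancel: "matrix_inv C *v (C *v x) = x" and L_cancel: "matrix_inv L *v (L *v y) = y"
  by (simp_all add: matrix_vector_mul_assoc positive_definite_matrix_inv(2) C_pd L_pd)

lemma D_Dinv [simp]: "D *v (Dinv *v x) = x"
  and Dinv_D [simp]: "Dinv *v (D *v x) = x"
  using positive_definite_matrix_inv[OF D_pd] by (simp_all add: matrix_vector_mul_assoc)

lemma Dinv_sym: "transpose Dinv = Dinv"
  using positive_definite_matrix_inv(3)[OF D_pd] by (simp add: positive_definite_def)

lemma Dinv_adj: "(Dinv *v x) \<bullet> y = x \<bullet> (Dinv *v y)"
  using inner_transpose_mult[of Dinv x y] by (simp add: Dinv_sym)

lemma Dinv_nonneg: "x \<bullet> (Dinv *v x) \<ge> 0"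
  using positive_definite_matrix_inv(3)[OF D_pd] unfolding positive_definite_def
  by (cases "x = 0") (auto intro: less_imp_le)

lemma L_i: "L *v i t = transpose B *v \<Phi> t - D *v q t"
  by (simp add: q_def)

text \<open>By \<open>eq_i\<close>, the derivative of
  \<open>transpose B *v \<Phi> t - L *v i t\<close> is \<open>D *v i t\<close>, and
  \<open>Dinv\<close> removes \<open>D\<close>.\<close>

lemma q_deriv: "t \<ge> 0 \<Longrightarrow> (q has_vector_derivative i t) (at t within {0..})"
proof -
  assume t: "t \<ge> 0"
  have "(q has_vector_derivative Dinv *v (transpose B *v v t - L *v i' t)) (at t within {0..})"
    unfolding q_def[abs_def]
    by (intro has_vector_derivative_matrix_vector_mult has_vector_derivative_diff v_deriv i_deriv \<Phi>_deriv t)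
  then show ?thesis by (simp add: eq_i[OF t])
qed

lemma \<Phi>_nth_deriv:
  "t \<ge> 0 \<Longrightarrow> ((\<lambda>t. \<Phi> t $ j) has_real_derivative v t $ j) (at t within {0..})"
  unfolding has_real_derivative_iff_has_vector_derivative
  by (rule bounded_linear.has_vector_derivative[OF bounded_linear_vec_nth \<Phi>_deriv])

section \<open>Integrated equations and the Lyapunov function\<close>

text \<open>Moved to one side, the non-constant terms have derivative 0 by \<open>eq_v\<close>
  together with \<open>q_deriv\<close>. The constant \<open>c\<close> collects the initial
  data.\<close>

lemma charge_balance:
  obtains c where "\<And>t. t \<ge> 0 \<Longrightarrow> C *v v t = c - M *v \<Phi> t - B *v q t - Qv (\<Phi> t)"
proof -
  have "((\<lambda>t. C *v v t + M *v \<Phi> t + B *v q t + Qv (\<Phi> t)) has_vector_derivative 0) (at t within {0..})"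
    if "t \<in> {0..}" for t
  proof -
    from that have t: "t \<ge> 0" by simp
    have "((\<lambda>t. Qv (\<Phi> t)) has_vector_derivative (\<chi> j. Q' j (\<Phi> t $ j) * v t $ j)) (at t within {0..})"
      unfolding Qv_def
    proof (rule has_vector_derivative_vec_lambda)
      show "((\<lambda>t. Q j (\<Phi> t $ j)) has_vector_derivative Q' j (\<Phi> t $ j) * v t $ j) (at t within {0..})" for j
        unfolding has_real_derivative_iff_has_vector_derivative[symmetric]
        by (rule DERIV_chain2[OF Q_deriv \<Phi>_nth_deriv[OF t]])
    qed
    then have "((\<lambda>t. C *v v t + M *v \<Phi> t + B *v q t + Qv (\<Phi> t)) has_vector_derivative
        C *v v' t + M *v v t + B *v i t + (\<chi> j. Q' j (\<Phi> t $ j) * v t $ j)) (at t within {0..})"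
      by (intro has_vector_derivative_matrix_vector_mult has_vector_derivative_add v_deriv \<Phi>_deriv q_deriv t)
    then show ?thesis by (simp add: eq_v[OF t])
  qed
  then show thesis
  proof (rule has_vector_derivative_zero_constant[OF convex_real_interval(1)])
    fix c assume "\<And>t. t \<in> {0..} \<Longrightarrow> C *v v t + M *v \<Phi> t + B *v q t + Qv (\<Phi> t) = c"
    then show thesis by (intro that[of c]) (auto simp: algebra_simps)
  qed
qed

text \<open>With \<open>x = C\<^sup>1\<^sup>/\<^sup>2 v\<close> and \<open>z = L\<^sup>1\<^sup>/\<^sup>2 i\<close>, the cross term is twice the pairing of \<open>z\<close> with the image
  of \<open>x\<close> under the matrix of norm less than \<open>1\<close>.\<close>

lemma cross_term_bound:
  obtains k where "k < 1"
    "\<And>x y. 2 * ((L *v y) \<bullet> (Dinv *v (transpose B *v x))) \<le> k * (x \<bullet> (C *v x) + y \<bullet> (L *v y))"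
proof
  define T where "T = diag_mat (\<chi> j. sqrt (ind $ j)) ** Dinv ** transpose B ** diag_mat (\<chi> j. 1 / sqrt (cap $ j))"
  define k where "k = onorm ((*v) T)"
  show "k < 1" using contraction by (simp add: k_def T_def spectral_norm_def)
  fix x :: "real ^ 'c" and y :: "real ^ 'l"
  define sx where "sx = (\<chi> j. sqrt (cap $ j) * x $ j)"
  define sy where "sy = (\<chi> j. sqrt (ind $ j) * y $ j)"
  have sq: "sqrt (cap $ j) * (sqrt (cap $ j) * u) = cap $ j * u"
    "sqrt (ind $ j') * (sqrt (ind $ j') * u) = ind $ j' * u" for j j' u
    using cap_pos[of j] ind_pos[of j'] by (simp_all flip: mult.assoc)
  \<comment> \<open>The last factor of \<open>T\<close> undoes the scaling of \<open>sx\<close>; the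
    first one, paired with \<open>sy\<close>, restores the full matrix \<open>L\<close>.\<close>
  have "diag_mat (\<chi> j. 1 / sqrt (cap $ j)) *v sx = x"
    using cap_pos by (simp add: diag_mat_mult_vec sx_def vec_eq_iff less_imp_neq[symmetric])
  then have "T *v sx = diag_mat (\<chi> j. sqrt (ind $ j)) *v (Dinv *v (transpose B *v x))"
    by (simp add: T_def matrix_vector_mul_assoc[symmetric])
  then have "sy \<bullet> (T *v sx) = (L *v y) \<bullet> (Dinv *v (transpose B *v x))"
    by (simp add: diag_mat_mult_vec sy_def inner_vec_def mult_ac abs_of_pos ind_pos cap_pos sq(2))
  then have "2 * ((L *v y) \<bullet> (Dinv *v (transpose B *v x))) \<le> 2 * (norm sy * (k * norm sx))"
    using norm_cauchy_schwarz[of sy "T *v sx"] onorm[OF matrix_vector_mul_bounded_linear, of T sx]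
    by (smt (verit) k_def mult_left_mono norm_ge_zero)
  also have "\<dots> = k * (2 * norm sy * norm sx)" by simp
  \<comment> \<open>Here \<open>2 * a * b\<close> is bounded by the sum of squares, which needs
    \<open>k\<close> nonnegative; an operator norm is.\<close>
  also have "\<dots> \<le> k * ((norm sy)\<^sup>2 + (norm sx)\<^sup>2)"
    unfolding k_def by (intro mult_left_mono sum_squares_bound onorm_pos_le) simp
  also have "(norm sy)\<^sup>2 = y \<bullet> (L *v y)"
    by (simp add: power2_norm_eq_inner diag_mat_mult_vec sy_def inner_vec_def mult_ac abs_of_pos ind_pos cap_pos sq(2))
  also have "(norm sx)\<^sup>2 = x \<bullet> (C *v x)"
    by (simp add: power2_norm_eq_inner diag_mat_mult_vec sx_def inner_vec_def mult_ac abs_of_pos ind_pos cap_pos sq(1))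
  finally show "2 * ((L *v y) \<bullet> (Dinv *v (transpose B *v x))) \<le> k * (x \<bullet> (C *v x) + y \<bullet> (L *v y))"
    by (simp add: add.commute)
qed

text \<open>The one-dimensional bounds add up because the slope \<open>g\<close> is common to all
  branches: the squared components sum to the squared norm.\<close>

lemma memristor_energy:
  obtains F where "\<And>j x. (F j has_real_derivative Q j x) (at x)"
    and "\<exists>k. \<forall>x. (\<Sum>j\<in>UNIV. F j (x $ j)) \<ge> g / 2 * (norm (x :: real ^ 'c))\<^sup>2 - k"
proof -
  have "\<exists>F k. (\<forall>x. (F has_real_derivative Q j x) (at x)) \<and> (\<forall>x. F x \<ge> g / 2 * x\<^sup>2 - k)" for j
  proof -
    obtain F where F: "\<And>x. (F has_real_derivative Q j x) (at x)"
      using continuous_has_antiderivative[OF Q_cont] by blast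
    obtain k where "\<And>x. F x \<ge> g / 2 * x\<^sup>2 - k"
      using antiderivative_quadratic_lower_bound[OF F growth r_pos] by metis
    with F show ?thesis by blast
  qed
  then obtain F k where F: "\<And>j x. (F j has_real_derivative Q j x) (at x)"
    and k: "\<And>j x. F j x \<ge> g / 2 * x\<^sup>2 - k j" by metis
  have "(\<Sum>j\<in>UNIV. F j (x $ j)) \<ge> g / 2 * (norm x)\<^sup>2 - sum k UNIV" for x :: "real ^ 'c"
  proof -
    have "g / 2 * (norm x)\<^sup>2 - sum k UNIV = (\<Sum>j\<in>UNIV. g / 2 * (x $ j)\<^sup>2 - k j)"
      by (simp add: power2_norm_eq_inner inner_vec_def sum_subtractf sum_distrib_left
          flip: power2_eq_square sum_divide_distrib)
    also have "\<dots> \<le> (\<Sum>j\<in>UNIV. F j (x $ j))" by (intro sum_mono k)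
    finally show ?thesis .
  qed
  with F that show thesis by blast
qed

text \<open>The lower bound keeps the term in \<open>L *v i t\<close>, so that the same function
  bounds both flux and current.\<close>

lemma lyapunov_function:
  obtains V V' a d k where "a > 0" "d > 0"
    and "\<And>t. t \<ge> 0 \<Longrightarrow> (V has_vector_derivative V' t) (at t within {0..})"
    and "\<And>t. t \<ge> 0 \<Longrightarrow> V' t \<le> - d * (norm (v t, i t))\<^sup>2"
    and "\<And>t. t \<ge> 0 \<Longrightarrow> a * (norm (\<Phi> t))\<^sup>2 + (L *v i t) \<bullet> (Dinv *v (L *v i t)) / 2 - k \<le> V t"
proof -
  obtain c where c: "\<And>t. t \<ge> 0 \<Longrightarrow> C *v v t = c - M *v \<Phi> t - B *v q t - Qv (\<Phi> t)"
    using charge_balance by blast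
  obtain F k0 where F: "\<And>j x. (F j has_real_derivative Q j x) (at x)"
    and k0: "\<And>x :: real ^ 'c. (\<Sum>j\<in>UNIV. F j (x $ j)) \<ge> g / 2 * (norm x)\<^sup>2 - k0"
    using memristor_energy by metis
  let ?Bt = "transpose B"
  define W where "W x = x \<bullet> (M *v x) / 2 + (\<Sum>j\<in>UNIV. F j (x $ j))
    + (?Bt *v x) \<bullet> (Dinv *v (?Bt *v x)) / 2 - c \<bullet> x" for x
  define V where "V t = W (\<Phi> t) + (L *v i t) \<bullet> (Dinv *v (L *v i t)) / 2" for t
  \<comment> \<open>The gradient of \<open>W\<close> along the trajectory is
    \<open>- (C *v v t) + B *v (Dinv *v (L *v i t))\<close>. Its pairing with \<open>v t\<close>
    gives one cross term, and differentiating the current term gives a second, equal one since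
    \<open>Dinv\<close> is symmetric.\<close>
  define V' where "V' t = 2 * ((L *v i t) \<bullet> (Dinv *v (?Bt *v v t))) - (v t \<bullet> (C *v v t) + i t \<bullet> (L *v i t))" for t
  have V_deriv: "(V has_vector_derivative V' t) (at t within {0..})" if t: "t \<ge> 0" for t
  proof -
    have sum: "((\<lambda>t. \<Sum>j\<in>UNIV. F j (\<Phi> t $ j)) has_vector_derivative Qv (\<Phi> t) \<bullet> v t) (at t within {0..})"
      unfolding inner_vec_def Qv_def vec_lambda_beta inner_real_def
    proof (rule has_vector_derivative_sum)
      show "((\<lambda>t. F j (\<Phi> t $ j)) has_vector_derivative Q j (\<Phi> t $ j) * v t $ j) (at t within {0..})" for j
        unfolding has_real_derivative_iff_has_vector_derivative[symmetric]
        by (rule DERIV_chain2[OF F \<Phi>_nth_deriv[OF t]])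
    qed
    have "(V has_vector_derivative
        2 * (v t \<bullet> (M *v \<Phi> t)) / 2 + Qv (\<Phi> t) \<bullet> v t
        + 2 * ((?Bt *v v t) \<bullet> (Dinv *v (?Bt *v \<Phi> t))) / 2 - c \<bullet> v t
        + 2 * ((L *v i' t) \<bullet> (Dinv *v (L *v i t))) / 2) (at t within {0..})"
      (is "(_ has_vector_derivative ?V') _")
      unfolding V_def[abs_def] W_def
      by (intro has_vector_derivative_add has_vector_derivative_diff has_vector_derivative_divide sum
          has_vector_derivative_quadratic_form[OF M_sym \<Phi>_deriv[OF t]]
          has_vector_derivative_quadratic_form[OF Dinv_sym has_vector_derivative_matrix_vector_mult[OF \<Phi>_deriv[OF t]]]
          has_vector_derivative_quadratic_form[OF Dinv_sym has_vector_derivative_matrix_vector_mult[OF i_deriv[OF t]]]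
          bounded_linear.has_vector_derivative[OF bounded_linear_inner_right \<Phi>_deriv[OF t]])
    moreover have "?V' = V' t"
    proof -
      have 1: "(L *v i' t) \<bullet> (Dinv *v (L *v i t)) = (L *v i t) \<bullet> (Dinv *v (?Bt *v v t)) - i t \<bullet> (L *v i t)"
        using Dinv_adj[of "L *v i' t" "L *v i t"]
        by (simp add: eq_i[OF t] matrix_vector_mult_diff_distrib inner_diff_left inner_diff_right inner_commute)
      have 2: "v t \<bullet> (C *v v t) = c \<bullet> v t - v t \<bullet> (M *v \<Phi> t) - v t \<bullet> (B *v q t) - Qv (\<Phi> t) \<bullet> v t"
        by (simp add: c[OF t] inner_diff_right inner_commute)
      have "v t \<bullet> (B *v q t) = (?Bt *v v t) \<bullet> (Dinv *v (?Bt *v \<Phi> t)) - (?Bt *v v t) \<bullet> (Dinv *v (L *v i t))"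
        unfolding inner_transpose_mult[of B, symmetric]
        by (simp add: q_def matrix_vector_mult_diff_distrib inner_diff_right)
      moreover have "(?Bt *v v t) \<bullet> (Dinv *v (L *v i t)) = (L *v i t) \<bullet> (Dinv *v (?Bt *v v t))"
        using Dinv_adj by (metis inner_commute)
      ultimately show ?thesis
        unfolding V'_def using 1 2 by linarith
    qed
    ultimately show ?thesis by simp
  qed
  obtain \<kappa> where \<kappa>: "\<kappa> < 1" "\<And>x y. 2 * ((L *v y) \<bullet> (Dinv *v (?Bt *v x))) \<le> \<kappa> * (x \<bullet> (C *v x) + y \<bullet> (L *v y))"
    using cross_term_bound by blast
  obtain a1 where a1: "a1 > 0" "\<And>y. a1 * (norm y)\<^sup>2 \<le> y \<bullet> (C *v y)" using positive_definite_coercive[OF C_pd] by blast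
  obtain a2 where a2: "a2 > 0" "\<And>y. a2 * (norm y)\<^sup>2 \<le> y \<bullet> (L *v y)" using positive_definite_coercive[OF L_pd] by blast
  \<comment> \<open>The factor \<open>1 - \<kappa>\<close> is the share of the dissipation left
    after the cross term; the minimum combines the coercivity constants of \<open>C\<close> and
    \<open>L\<close>.\<close>
  define d where "d = (1 - \<kappa>) * min a1 a2"
  have "d > 0" using \<kappa> a1 a2 by (simp add: d_def)
  have V'_le: "V' t \<le> - d * (norm (v t, i t))\<^sup>2" for t
  proof -
    have "min a1 a2 * (norm (v t))\<^sup>2 \<le> v t \<bullet> (C *v v t)"
      by (rule order_trans[OF mult_right_mono a1(2)]) auto
    moreover have "min a1 a2 * (norm (i t))\<^sup>2 \<le> i t \<bullet> (L *v i t)"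
      by (rule order_trans[OF mult_right_mono a2(2)]) auto
    ultimately have "min a1 a2 * (norm (v t, i t))\<^sup>2 \<le> v t \<bullet> (C *v v t) + i t \<bullet> (L *v i t)"
      by (simp add: norm_Pair algebra_simps)
    then have "d * (norm (v t, i t))\<^sup>2 \<le> (1 - \<kappa>) * (v t \<bullet> (C *v v t) + i t \<bullet> (L *v i t))"
      unfolding d_def mult.assoc using \<kappa>(1) by (intro mult_left_mono) auto
    with \<kappa>(2)[of "i t" "v t"] show ?thesis by (simp add: V'_def algebra_simps)
  qed
  \<comment> \<open>The form of \<open>M\<close> and the memristor energy together have quadratic
    growth \<open>(g - m) / 2\<close>, which is \<open>2 * a\<close>. One half absorbs the linear
    term in \<open>c\<close> by completing a square, the other remains.\<close>
  define a where "a = (g - m) / 4"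
  have "a > 0" using m_less by (simp add: a_def)
  have W_ge: "a * (norm x)\<^sup>2 - (k0 + (norm c)\<^sup>2 / (4 * a)) \<le> W x" for x
  proof -
    have "c \<bullet> x \<le> norm c * norm x" by (rule norm_cauchy_schwarz)
    also have "\<dots> \<le> a * (norm x)\<^sup>2 + (norm c)\<^sup>2 / (4 * a)"
    proof -
      have "0 \<le> (2 * a * norm x - norm c)\<^sup>2 / (4 * a)" using \<open>a > 0\<close> by simp
      also have "\<dots> = a * (norm x)\<^sup>2 + (norm c)\<^sup>2 / (4 * a) - norm c * norm x"
        using \<open>a > 0\<close> by (simp add: power2_eq_square field_simps)
      finally show ?thesis by simp
    qed
    finally have "c \<bullet> x \<le> a * (norm x)\<^sup>2 + (norm c)\<^sup>2 / (4 * a)" .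
    moreover have "2 * a * (norm x)\<^sup>2 - k0 \<le> x \<bullet> (M *v x) / 2 + (\<Sum>j\<in>UNIV. F j (x $ j))"
      using M_lower[of x] k0[of x] by (simp add: a_def algebra_simps add_divide_distrib diff_divide_distrib)
    ultimately show ?thesis using Dinv_nonneg[of "?Bt *v x"] unfolding W_def by simp
  qed
  show thesis
  proof (rule that[OF \<open>a > 0\<close> \<open>d > 0\<close> V_deriv V'_le])
    show "a * (norm (\<Phi> t))\<^sup>2 + (L *v i t) \<bullet> (Dinv *v (L *v i t)) / 2 - (k0 + (norm c)\<^sup>2 / (4 * a)) \<le> V t" for t
      using W_ge[of "\<Phi> t"] by (simp add: V_def)
  qed
qed

section \<open>Boundedness of the trajectory\<close>

text \<open>The Lyapunov function never exceeds its initial value, and both variable terms of its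
  lower bound are nonnegative, so each is bounded separately.\<close>

lemma bounded_states: "bounded ((\<lambda>t. (\<Phi> t, i t)) ` {0..})"
proof -
  obtain V V' a d k where a: "a > 0" "d > 0"
    and V: "\<And>t. t \<ge> 0 \<Longrightarrow> (V has_vector_derivative V' t) (at t within {0..})"
    and V': "\<And>t. t \<ge> 0 \<Longrightarrow> V' t \<le> - d * (norm (v t, i t))\<^sup>2"
    and lower: "\<And>t. t \<ge> 0 \<Longrightarrow> a * (norm (\<Phi> t))\<^sup>2 + (L *v i t) \<bullet> (Dinv *v (L *v i t)) / 2 - k \<le> V t"
    using lyapunov_function by metis
  have "V' t \<le> 0" if "t \<ge> 0" for t
    by (rule order_trans[OF V'[OF that]]) (use a in simp)
  then have V0: "V t \<le> V 0" if "t \<ge> 0" for t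
    using nonpos_derivative_antimono_half_line[of V V' 0 t] V that by simp
  have "bounded (\<Phi> ` {0..})"
  proof (rule bounded_norm_squareI[OF a(1)])
    show "a * (norm (\<Phi> t))\<^sup>2 \<le> V 0 + k" if "t \<ge> 0" for t
      using lower[OF that] V0[OF that] Dinv_nonneg[of "L *v i t"] by simp
  qed
  moreover obtain b where b: "b > 0" "\<And>y. b * (norm y)\<^sup>2 \<le> y \<bullet> (Dinv *v y)"
    using positive_definite_coercive positive_definite_matrix_inv(3)[OF D_pd] by blast
  have "bounded ((\<lambda>t. L *v i t) ` {0..})"
  proof (rule bounded_norm_squareI[OF b(1)])
    show "b * (norm (L *v i t))\<^sup>2 \<le> 2 * (V 0 + k)" if "t \<ge> 0" for t
    proof -
      have "0 \<le> a * (norm (\<Phi> t))\<^sup>2" using a by simp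
      then show ?thesis using lower[OF that] V0[OF that] b(2)[of "L *v i t"] by simp
    qed
  qed
  then have "bounded ((\<lambda>y. matrix_inv L *v y) ` (\<lambda>t. L *v i t) ` {0..})"
    by (rule bounded_linear_image) simp
  then have "bounded (i ` {0..})"
    by (simp add: image_image L_cancel)
  ultimately have "bounded (\<Phi> ` {0..} \<times> i ` {0..})" by (rule bounded_Times)
  then show ?thesis by (rule bounded_subset) auto
qed

lemma bounded_q: "bounded (q ` {0..})"
proof -
  have "bounded ((\<lambda>(x, y). Dinv *v (transpose B *v x - L *v y)) ` (\<lambda>t. (\<Phi> t, i t)) ` {0..})"
    unfolding case_prod_unfold
    by (intro bounded_continuous_image_UNIV[OF _ bounded_states] continuous_intros continuous_on_matrix_vector_mult)
  then show ?thesis by (simp add: image_image q_def[abs_def])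
qed

text \<open>The dissipation controls \<open>v\<close> only through an integral over time. The
  pointwise bound comes from the charge balance, by which \<open>v\<close> is a continuous function
  of flux and current.\<close>

lemma bounded_v: "bounded (v ` {0..})"
proof -
  obtain c where c: "\<And>t. t \<ge> 0 \<Longrightarrow> C *v v t = c - M *v \<Phi> t - B *v q t - Qv (\<Phi> t)"
    using charge_balance by blast
  have "bounded ((\<lambda>p. matrix_inv C *v (c - M *v fst p
     - B *v (Dinv *v (transpose B *v fst p - L *v snd p)) - Qv (fst p))) ` (\<lambda>t. (\<Phi> t, i t)) ` {0..})"
    by (intro bounded_continuous_image_UNIV[OF _ bounded_states] continuous_intros
        continuous_on_matrix_vector_mult continuous_on_compose2[OF Qv_cont]) auto
  then have "bounded ((\<lambda>t. matrix_inv C *v (c - M *v \<Phi> t - B *v q t - Qv (\<Phi> t))) ` {0..})"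
    by (simp add: image_image q_def)
  moreover have "matrix_inv C *v (c - M *v \<Phi> t - B *v q t - Qv (\<Phi> t)) = v t" if "t \<ge> 0" for t
    using C_cancel c[OF that] by metis
  ultimately show ?thesis
    by (metis (no_types, lifting) atLeast_iff image_cong)
qed

text \<open>The state equations express the derivatives continuously through the bounded states;
  this supplies the Lipschitz constant for \<open>v_i_tendsto_zero\<close>.\<close>

lemma bounded_derivative: "bounded ((\<lambda>t. (v' t, i' t)) ` {0..})"
proof -
  have "bounded ((\<lambda>t. (\<Phi> t, i t)) ` {0..} \<times> v ` {0..})"
    by (intro bounded_Times bounded_states bounded_v)
  then have bdd: "bounded ((\<lambda>t. (v t, i t, \<Phi> t)) ` {0..})"
    by (rule bounded_subset[OF bounded_continuous_image_UNIV[where f = "\<lambda>p. (snd p, snd (fst p), fst (fst p))", rotated]])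
       (auto intro!: continuous_intros rev_image_eqI)
  have "bounded ((\<lambda>p. (matrix_inv C *v (- (M *v fst p) - B *v fst (snd p)
           - (\<chi> j. Q' j (snd (snd p) $ j) * fst p $ j)),
        matrix_inv L *v (transpose B *v fst p - D *v fst (snd p)))) ` (\<lambda>t. (v t, i t, \<Phi> t)) ` {0..})"
    by (intro bounded_continuous_image_UNIV[OF _ bdd] continuous_intros
        continuous_on_matrix_vector_mult continuous_on_compose2[OF Q'_cont]) auto
  then have "bounded ((\<lambda>t. (matrix_inv C *v (- (M *v v t) - B *v i t - (\<chi> j. Q' j (\<Phi> t $ j) * v t $ j)),
        matrix_inv L *v (transpose B *v v t - D *v i t))) ` {0..})"
    by (simp add: image_image)
  moreover have "(matrix_inv C *v (- (M *v v t) - B *v i t - (\<chi> j. Q' j (\<Phi> t $ j) * v t $ j)),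
        matrix_inv L *v (transpose B *v v t - D *v i t)) = (v' t, i' t)" if "t \<ge> 0" for t
    using C_cancel L_cancel eq_v[OF that] eq_i[OF that] by metis
  ultimately show ?thesis
    by (metis (no_types, lifting) atLeast_iff image_cong)
qed

section \<open>Convergence of the trajectory\<close>

lemma v_i_tendsto_zero: "((\<lambda>t. (v t, i t)) \<longlongrightarrow> 0) at_top"
proof -
  obtain V V' a d k where a: "a > 0" "d > 0"
    and V: "\<And>t. t \<ge> 0 \<Longrightarrow> (V has_vector_derivative V' t) (at t within {0..})"
    and V': "\<And>t. t \<ge> 0 \<Longrightarrow> V' t \<le> - d * (norm (v t, i t))\<^sup>2"
    and lower: "\<And>t. t \<ge> 0 \<Longrightarrow> a * (norm (\<Phi> t))\<^sup>2 + (L *v i t) \<bullet> (Dinv *v (L *v i t)) / 2 - k \<le> V t"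
    using lyapunov_function by metis
  obtain K where K: "\<And>t. t \<ge> 0 \<Longrightarrow> norm (v' t, i' t) \<le> K"
    using bounded_derivative unfolding bounded_iff by auto
  show ?thesis
  proof (rule dissipation_tendsto_zero[OF V V' a(2)])
    show "- k \<le> V t" if "t \<ge> 0" for t
    proof -
      have "0 \<le> a * (norm (\<Phi> t))\<^sup>2" using a by simp
      then show ?thesis using lower[OF that] Dinv_nonneg[of "L *v i t"] by simp
    qed
    show "norm ((v t, i t) - (v s, i s)) \<le> K * (t - s)" if "0 \<le> s" "s \<le> t" for s t
    proof -
      have "norm ((v t, i t) - (v s, i s)) \<le> K * norm (t - s)"
      proof (rule differentiable_bound[of "{0..}"])
        show "((\<lambda>t. (v t, i t)) has_derivative (\<lambda>h. h *\<^sub>R (v' t, i' t))) (at t within {0..})"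
          if "t \<in> {0..}" for t
          using has_vector_derivative_Pair[OF v_deriv i_deriv] that
          by (simp add: has_vector_derivative_def)
        show "onorm (\<lambda>h. h *\<^sub>R (v' t, i' t)) \<le> K" if "t \<in> {0..}" for t
          using mult_right_mono[OF K[of t] abs_ge_zero] that
          by (intro onorm_le) (simp add: mult.commute del: scaleR_Pair)
      qed (use that in auto)
      then show ?thesis using that by simp
    qed
  qed
qed

text \<open>These are the equilibrium points of (F) for the initial state of the trajectory, with
  both coordinates measured from their values at time 0.\<close>

definition flux_charge_equilibria :: "((real ^ 'c) \<times> (real ^ 'l)) set" where
  "flux_charge_equilibria = {(x, y). C *v v 0 - M *v x - B *v y - (Qv (x + \<Phi> 0) - Qv (\<Phi> 0)) = 0
     \<and> L *v i 0 + transpose B *v x - D *v y = 0}"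

text \<open>In the shifted coordinates \<open>z\<close> the right-hand sides of (F) are
  \<open>C *v v t\<close> and \<open>L *v i t\<close>, which tend to 0. By continuity every limit
  point of \<open>z\<close> is an equilibrium, and discreteness forces convergence.\<close>

lemma flux_converges:
  assumes discrete: "discrete flux_charge_equilibria"
  obtains p where "(\<Phi> \<longlongrightarrow> p) at_top"
proof -
  define z where "z t = (\<Phi> t - \<Phi> 0, q t - q 0)" for t
  obtain c where c: "\<And>t. t \<ge> 0 \<Longrightarrow> C *v v t = c - M *v \<Phi> t - B *v q t - Qv (\<Phi> t)"
    using charge_balance by blast
  \<comment> \<open>Subtracting the charge balance at time 0 replaces \<open>c\<close> by the
    initial data.\<close>
  have Cv: "C *v v t = C *v v 0 - M *v fst (z t) - B *v snd (z t) - (Qv (fst (z t) + \<Phi> 0) - Qv (\<Phi> 0))"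
    if "t \<ge> 0" for t
    using c[OF that] c[of 0] by (simp add: z_def matrix_vector_mult_diff_distrib)
  have Li: "L *v i t = L *v i 0 + transpose B *v fst (z t) - D *v snd (z t)" for t
    by (simp add: z_def L_i matrix_vector_mult_diff_distrib)
  have cont: "continuous_on {0..} z"
    unfolding z_def[abs_def] continuous_on_eq_continuous_within
    using \<Phi>_deriv q_deriv by (auto intro!: continuous_intros dest: has_vector_derivative_continuous)
  have "bounded (\<Phi> ` {0..})"
    using bounded_fst[OF bounded_states] by (simp add: image_image)
  then have "bounded ((\<lambda>t. \<Phi> t - \<Phi> 0) ` {0..} \<times> (\<lambda>t. q t - q 0) ` {0..})"
    using bounded_q by (intro bounded_Times bounded_minus_comp) (auto simp: image_constant_conv)
  then have bdd: "bounded (z ` {0..})"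
    by (rule bounded_subset) (auto simp: z_def)
  have lim: "l \<in> flux_charge_equilibria"
    if s: "filterlim s at_top sequentially" and l: "(\<lambda>n. z (s n)) \<longlonglongrightarrow> l" for s :: "nat \<Rightarrow> real" and l
  proof -
    have vi: "(\<lambda>n. (v (s n), i (s n))) \<longlonglongrightarrow> (0, 0)"
      using filterlim_compose[OF v_i_tendsto_zero s] by (simp add: zero_prod_def)
    have mult: "(\<lambda>n. A *v f n) \<longlonglongrightarrow> A *v x" if "f \<longlonglongrightarrow> x" for A :: "real ^ 'n ^ 'm" and f x
      using bounded_linear.tendsto[OF matrix_vector_mul_bounded_linear that] .
    have l1: "(\<lambda>n. fst (z (s n))) \<longlonglongrightarrow> fst l" and l2: "(\<lambda>n. snd (z (s n))) \<longlonglongrightarrow> snd l"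
      using l by (auto intro: tendsto_intros)
    have Q: "(\<lambda>n. Qv (fst (z (s n)) + \<Phi> 0)) \<longlonglongrightarrow> Qv (fst l + \<Phi> 0)"
      by (rule continuous_on_tendsto_compose[OF Qv_cont]) (auto intro!: tendsto_intros l1)
    have C0: "(\<lambda>n. C *v v (s n)) \<longlonglongrightarrow> C *v 0"
      using tendsto_fst[OF vi] by (intro mult) simp
    have Cl: "(\<lambda>n. C *v v (s n)) \<longlonglongrightarrow> C *v v 0 - M *v fst l - B *v snd l - (Qv (fst l + \<Phi> 0) - Qv (\<Phi> 0))"
    proof (rule Lim_transform_eventually)
      show "(\<lambda>n. C *v v 0 - M *v fst (z (s n)) - B *v snd (z (s n)) - (Qv (fst (z (s n)) + \<Phi> 0) - Qv (\<Phi> 0)))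
        \<longlonglongrightarrow> C *v v 0 - M *v fst l - B *v snd l - (Qv (fst l + \<Phi> 0) - Qv (\<Phi> 0))"
        by (intro tendsto_intros mult[OF l1] mult[OF l2] Q)
      \<comment> \<open>The identity \<open>Cv\<close> holds only for nonnegative times, and
        finitely many \<open>s n\<close> may be negative.\<close>
      have "\<forall>\<^sub>F n in sequentially. 0 \<le> s n" using s by (simp add: filterlim_at_top)
      then show "\<forall>\<^sub>F n in sequentially. C *v v 0 - M *v fst (z (s n)) - B *v snd (z (s n))
          - (Qv (fst (z (s n)) + \<Phi> 0) - Qv (\<Phi> 0)) = C *v v (s n)"
        by eventually_elim (rule Cv[symmetric])
    qed
    have 1: "C *v v 0 - M *v fst l - B *v snd l - (Qv (fst l + \<Phi> 0) - Qv (\<Phi> 0)) = 0"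
      using LIMSEQ_unique[OF Cl C0] by simp
    have L0: "(\<lambda>n. L *v i (s n)) \<longlonglongrightarrow> L *v 0"
      using tendsto_snd[OF vi] by (intro mult) simp
    have Ll: "(\<lambda>n. L *v i (s n)) \<longlonglongrightarrow> L *v i 0 + transpose B *v fst l - D *v snd l"
    proof -
      have "(\<lambda>n. L *v i (s n)) = (\<lambda>n. L *v i 0 + transpose B *v fst (z (s n)) - D *v snd (z (s n)))"
        by (rule ext) (rule Li)
      then show ?thesis by (simp only:) (intro tendsto_intros mult[OF l1] mult[OF l2])
    qed
    have "L *v i 0 + transpose B *v fst l - D *v snd l = 0"
      using LIMSEQ_unique[OF Ll L0] by simp
    with 1 show ?thesis by (simp add: flux_charge_equilibria_def case_prod_unfold)
  qed
  have "\<exists>l. (z \<longlongrightarrow> l) at_top"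
    by (rule tendsto_of_discrete_limit_points[OF cont bdd _ discrete]) (use lim in blast)+
  then obtain l where "(z \<longlongrightarrow> l) at_top" ..
  then have "((\<lambda>t. fst (z t) + \<Phi> 0) \<longlongrightarrow> fst l + \<Phi> 0) at_top"
    by (intro tendsto_intros)
  then show thesis using that by (simp add: z_def)
qed

end

section \<open>Application to the circuit\<close>

theorem theorem4:
  fixes N :: "('v, 'e, 'c::finite, 'l::finite) circuit"
    and Gm Phi_t :: "'c \<Rightarrow> real"
  assumes "RLCMa N"
    and "memristor_assumption N Gm Phi_t"
    and "Min (range Gm) > \<bar>least_eigenvalue (H_aa N)\<bar>"
    and "positive_definite (H_bb N)"
    and "spectral_norm (diag_mat (\<chi> j. sqrt (inductance N $ j)) ** matrix_inv (H_bb N)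
           ** transpose (H_ab N) ** diag_mat (\<chi> i. 1 / sqrt (capacitance N $ i))) < 1"
  shows "(\<forall>w. solution_V N w \<longrightarrow>
            bounded (w ` {0..})
            \<and> ((\<lambda>t. infdist (w t) (equilibria_V N)) \<longlongrightarrow> 0) at_top
            \<and> ((\<lambda>t. fst (w t)) \<longlongrightarrow> 0) at_top
            \<and> ((\<lambda>t. fst (snd (w t))) \<longlongrightarrow> 0) at_top)
       \<and> (\<forall>w0. discrete (equilibria_F N w0) \<longrightarrow>
            (\<forall>w. solution_V N w \<and> w 0 = w0 \<longrightarrow>
              (\<exists>Phi_bar. (0, 0, Phi_bar) \<in> equilibria_V N
                 \<and> (w \<longlongrightarrow> (0, 0, Phi_bar)) at_top)))"
proof -
  note mem = assms(2)[unfolded memristor_assumption_def, rule_format]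
  have sym: "transpose (H_aa N) = H_aa N"
    by (simp add: H_aa_def transpose_def vec_eq_iff mult_ac)
  \<comment> \<open>The Rayleigh bound is weakened from the least eigenvalue to minus its absolute
    value, the form in which the first assumption on the memristors enters.\<close>
  have lower: "- \<bar>least_eigenvalue (H_aa N)\<bar> * (norm x)\<^sup>2 \<le> x \<bullet> (H_aa N *v x)" for x
    by (rule order_trans[OF mult_right_mono least_eigenvalue_le[OF sym]]) auto
  have deriv: "(mem_charge N j has_real_derivative deriv (mem_charge N j) x) (at x)" for j x
    using mem[of j] unfolding C1_differentiable_on_eq
    by (simp add: DERIV_deriv_iff_real_differentiable)
  have deriv_cont: "continuous_on UNIV (deriv (mem_charge N j))" for j
  proof -
    have "vector_derivative (mem_charge N j) (at x) = deriv (mem_charge N j) x" for x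
      using deriv[of j x] by (simp add: has_real_derivative_iff_has_vector_derivative vector_derivative_at)
    then show ?thesis using mem[of j] by (simp add: C1_differentiable_on_eq)
  qed
  have mem_deriv: "mem_deriv_mat N x *v y = (\<chi> j. deriv (mem_charge N j) (x $ j) * y $ j)" for x y
    by (simp add: mem_deriv_mat_def diag_mat_mult_vec)
  have traj: "memristor_trajectory (H_aa N) (H_ab N) (H_bb N) (capacitance N) (inductance N)
      (mem_charge N) (\<lambda>j. deriv (mem_charge N j)) Phi_t \<bar>least_eigenvalue (H_aa N)\<bar> (Min (range Gm))
      (\<lambda>t. fst (w t)) (\<lambda>t. snd (snd (w t))) (\<lambda>t. fst (w' t)) (\<lambda>t. fst (snd (w t))) (\<lambda>t. fst (snd (w' t)))"
    if w': "\<And>t. t \<ge> 0 \<Longrightarrow> (w has_vector_derivative w' t) (at t within {0..})"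
      and eq: "\<And>t. t \<ge> 0 \<Longrightarrow> V_eqn N (w t) (w' t)" for w w'
  proof
    show "capacitance N $ j > 0" "inductance N $ k > 0" for j k
      using assms(1) by (auto simp: RLCMa_def)
    show "Min (range Gm) \<le> mem_charge N j x / x" if "Phi_t j < \<bar>x\<bar>" for j x
      using mem[of j] that by (intro order_trans[OF Min_le[of _ "Gm j"]]) auto
    show "Phi_t j > 0" for j using mem[of j] by simp
    fix t :: real assume t: "t \<ge> 0"
    show "((\<lambda>t. fst (w t)) has_vector_derivative fst (w' t)) (at t within {0..})"
      by (rule bounded_linear.has_vector_derivative[OF bounded_linear_fst w'[OF t]])
    have snd: "((\<lambda>t. snd (w t)) has_vector_derivative snd (w' t)) (at t within {0..})"
      by (rule bounded_linear.has_vector_derivative[OF bounded_linear_snd w'[OF t]])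
    show "((\<lambda>t. fst (snd (w t))) has_vector_derivative fst (snd (w' t))) (at t within {0..})"
      by (rule bounded_linear.has_vector_derivative[OF bounded_linear_fst snd])
    have "snd (snd (w' t)) = fst (w t)"
      using eq[OF t] by (auto simp: V_eqn_def split: prod.splits)
    then show "((\<lambda>t. snd (snd (w t))) has_vector_derivative fst (w t)) (at t within {0..})"
      using bounded_linear.has_vector_derivative[OF bounded_linear_snd snd] by simp
    show "diag_mat (capacitance N) *v fst (w' t) = - (H_aa N *v fst (w t)) - H_ab N *v fst (snd (w t))
        - (\<chi> j. deriv (mem_charge N j) (snd (snd (w t)) $ j) * fst (w t) $ j)"
      using eq[OF t] by (auto simp: V_eqn_def H_mult_def mem_deriv split: prod.splits)
    show "diag_mat (inductance N) *v fst (snd (w' t)) = transpose (H_ab N) *v fst (w t) - H_bb N *v fst (snd (w t))"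
      using eq[OF t] by (auto simp: V_eqn_def H_mult_def uminus_matrix_vector_mult split: prod.splits)
  qed (use sym lower assms deriv deriv_cont in auto)
  \<comment> \<open>With zero voltage the memristor term vanishes whatever the flux is.\<close>
  have equil: "(0, 0, p) \<in> equilibria_V N" for p
    by (simp add: equilibria_V_def V_eqn_def H_mult_def zero_prod_def)
  have part1: "bounded (w ` {0..})" "((\<lambda>t. (fst (w t), fst (snd (w t)))) \<longlongrightarrow> 0) at_top"
    and part2: "discrete (equilibria_F N (w 0)) \<Longrightarrow> \<exists>p. ((\<lambda>t. snd (snd (w t))) \<longlongrightarrow> p) at_top"
    if sol: "solution_V N w" for w
  proof -
    from sol obtain w' where w': "\<And>t. t \<ge> 0 \<Longrightarrow> (w has_vector_derivative w' t) (at t within {0..})"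
      "\<And>t. t \<ge> 0 \<Longrightarrow> V_eqn N (w t) (w' t)"
      unfolding solution_V_def by blast
    interpret memristor_trajectory "H_aa N" "H_ab N" "H_bb N" "capacitance N" "inductance N"
      "mem_charge N" "\<lambda>j. deriv (mem_charge N j)" Phi_t "\<bar>least_eigenvalue (H_aa N)\<bar>" "Min (range Gm)"
      "\<lambda>t. fst (w t)" "\<lambda>t. snd (snd (w t))" "\<lambda>t. fst (w' t)" "\<lambda>t. fst (snd (w t))" "\<lambda>t. fst (snd (w' t))"
      by (rule traj[OF w'])
    have "bounded ((\<lambda>t. fst (w t)) ` {0..} \<times> (\<lambda>t. fst (snd (w t))) ` {0..} \<times> (\<lambda>t. snd (snd (w t))) ` {0..})"
      using bounded_v bounded_fst[OF bounded_states] bounded_snd[OF bounded_states]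
      by (intro bounded_Times) (simp_all add: image_image)
    then show "bounded (w ` {0..})"
      by (rule bounded_subset) (intro image_subsetI, auto simp: mem_Times_iff intro: rev_image_eqI)
    show "((\<lambda>t. (fst (w t), fst (snd (w t)))) \<longlongrightarrow> 0) at_top" by (rule v_i_tendsto_zero)
    assume "discrete (equilibria_F N (w 0))"
    moreover have "equilibria_F N (w 0) = flux_charge_equilibria"
    proof -
      have "mem_charge_vec N = Qv" by (simp add: fun_eq_iff mem_charge_vec_def Qv_def)
      then show ?thesis
        unfolding equilibria_F_def F_eqn_def H_mult_def flux_charge_equilibria_def case_prod_unfold
        by (simp add: uminus_matrix_vector_mult prod_eq_iff algebra_simps) auto
    qed
    ultimately show "\<exists>p. ((\<lambda>t. snd (snd (w t))) \<longlongrightarrow> p) at_top"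
      using flux_converges by metis
  qed
  have fst0: "((\<lambda>t. fst (w t)) \<longlongrightarrow> 0) at_top" and snd0: "((\<lambda>t. fst (snd (w t))) \<longlongrightarrow> 0) at_top"
    if "solution_V N w" for w
    using tendsto_fst[OF part1(2)[OF that]] tendsto_snd[OF part1(2)[OF that]] by simp_all
  have "((\<lambda>t. infdist (w t) (equilibria_V N)) \<longlongrightarrow> 0) at_top" if sol: "solution_V N w" for w
  proof (rule tendsto_sandwich[OF _ _ tendsto_const])
    show "\<forall>\<^sub>F t in at_top. 0 \<le> infdist (w t) (equilibria_V N)" by (simp add: infdist_nonneg)
    \<comment> \<open>The comparison point is the equilibrium with the current flux of the
      trajectory, so it moves with \<open>t\<close>; no convergence of the flux is involved.\<close>
    have "infdist (w t) (equilibria_V N) \<le> norm (fst (w t), fst (snd (w t)))" for t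
      using infdist_le[OF equil[of "snd (snd (w t))"], of "w t"]
      by (cases "w t") (simp add: dist_norm norm_Pair)
    then show "\<forall>\<^sub>F t in at_top. infdist (w t) (equilibria_V N) \<le> norm (fst (w t), fst (snd (w t)))" by simp
    show "((\<lambda>t. norm (fst (w t), fst (snd (w t)))) \<longlongrightarrow> 0) at_top"
      using tendsto_norm[OF part1(2)[OF sol]] by simp
  qed
  moreover have "\<exists>p. (0, 0, p) \<in> equilibria_V N \<and> (w \<longlongrightarrow> (0, 0, p)) at_top"
    if sol: "solution_V N w" and dis: "discrete (equilibria_F N (w 0))" for w
  proof -
    obtain p where "((\<lambda>t. snd (snd (w t))) \<longlongrightarrow> p) at_top" using part2[OF sol dis] by blast
    then have "((\<lambda>t. (fst (w t), fst (snd (w t)), snd (snd (w t)))) \<longlongrightarrow> (0, 0, p)) at_top"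
      by (intro tendsto_Pair fst0[OF sol] snd0[OF sol])
    then show ?thesis using equil by auto
  qed
  ultimately show ?thesis using part1(1) fst0 snd0 by blast
qed

end
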